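(* Let $q$ be a prime power and let $n$ be a positive integer with $4\mid n$. Let $C$ be a $q$-ary Singleton-optimal locally repairable code of length $n$, minimum distance $d=6$ and locality $r=3$ with disjoint repair groups. Then \[ n \le 4\left\lfloor \frac{7q+3+\sqrt{24q^3+q^2-6q-63}}{24}\right\rfloor = O(q^{1.5}). \]
   Context: Codes are linear: an $[n,k,d]_q$ code $C$ is a $k$-dimensional subspace of $\mathbb{F}_q^n$ ($k\ge 1$) with minimum Hamming distance $d$; $C^\perp$ is its dual code. $C$ is a locally repairable code (LRC) with locality $r$ if for every coordinate $i\in[n]=\{1,\dots,n\}$ there is a codeword $\bm h\in C^\perp$ with $i\in\mathrm{supp}(\bm h)$ and Hamming weight at most $r+1$. When $(r+1)\mid n$, $C$ has disjoint repair groups if there are $\ell=n/(r+1)$ codewords $\bm h_1,\dots,\bm h_\ell\in C^\perp$, each of Hamming weight exactly $r+1$, with pairwise disjoint supports (so the supports partition $[n]$). Every such LRC satisfies the Singleton-type bound $d\le n-k-\lceil k/r\rceil+2$; $C$ is called Singleton-optimal if equality holds. For $d=6$, $r=3$, $4\mid n$ this is equivalent to $n-k=n/4+3$. *)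

theory Defs
  imports "HOL-Analysis.Analysis" "HOL-Library.Disjoint_Sets" "HOL-Library.Landau_Symbols"
begin

(* Words of length n over the field with q elements are vectors of type 'a ^ 'n, where 'a is a
   finite field with CARD('a) = q and the coordinate set [n] is the type 'n with CARD('n) = n. *)

definition supp :: "'a::zero ^ 'n \<Rightarrow> 'n set" where
  "supp x = {i. x $ i \<noteq> 0}"

definition hamming_weight :: "'a::zero ^ 'n \<Rightarrow> nat" where
  "hamming_weight x = card (supp x)"

definition hamming_dist :: "'a ^ 'n \<Rightarrow> 'a ^ 'n \<Rightarrow> nat" where
  "hamming_dist x y = card {i. x $ i \<noteq> y $ i}"

definition linear_code :: "('a::{field,finite} ^ 'n) set \<Rightarrow> bool" where
  "linear_code C \<longleftrightarrow> vec.subspace C \<and> vec.dim C \<ge> 1"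

(* Unspecified if C has fewer than two elements; this cannot happen for a linear_code. *)
definition min_distance :: "('a ^ 'n) set \<Rightarrow> nat" where
  "min_distance C = Min {hamming_dist x y | x y. x \<in> C \<and> y \<in> C \<and> x \<noteq> y}"

definition dual_code :: "('a::field ^ 'n) set \<Rightarrow> ('a ^ 'n) set" where
  "dual_code C = {h. \<forall>c\<in>C. (\<Sum>i\<in>UNIV. h $ i * c $ i) = 0}"

definition has_locality :: "nat \<Rightarrow> ('a::field ^ 'n) set \<Rightarrow> bool" where
  "has_locality r C \<longleftrightarrow>
     (\<forall>i. \<exists>h\<in>dual_code C. i \<in> supp h \<and> hamming_weight h \<le> r + 1)"

definition disjoint_repair_groups :: "nat \<Rightarrow> ('a::field ^ 'n) set \<Rightarrow> bool" where
  "disjoint_repair_groups r C \<longleftrightarrow>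
     (r + 1) dvd CARD('n) \<and>
     (\<exists>h :: nat \<Rightarrow> 'a ^ 'n.
        (\<forall>j < CARD('n) div (r + 1). h j \<in> dual_code C \<and> hamming_weight (h j) = r + 1) \<and>
        disjoint_family_on (\<lambda>j. supp (h j)) {..<CARD('n) div (r + 1)})"

definition singleton_optimal :: "nat \<Rightarrow> ('a::field ^ 'n) set \<Rightarrow> bool" where
  "singleton_optimal r C \<longleftrightarrow>
     int (min_distance C)
       = int CARD('n) - int (vec.dim C) - \<lceil>real (vec.dim C) / real r\<rceil> + 2"

end

theory Submission
  imports Defs "HOL-Real_Asymp.Real_Asymp"
begin

text \<open>
  Let $n = 4l$ and let $D$ be the space of words orthogonal to the $l$ repair words; singleton
  optimality says that $C$ has codimension 3 in $D$, so some linear map $\phi$ from $D$ to the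
  3-dimensional space over the field has its kernel inside $C$. Since $C$ has no nonzero words of weight at most 5,
  $\phi$ separates words of $D$ whose supports together cover at most 5 coordinates. Consequently the six
  pairs and four triples inside a repair group become the six vertices and four lines of a complete
  quadrilateral in the projective plane, and no vertex of one quadrilateral lies on a line of another.
  The $q^2 + q + 1 - 6l$ remaining points carry $4l(q - 2)$ incidences with the $4l$ lines, while
  two lines of different quadrilaterals share at most one of these points and two lines of the same quadrilateral
  share none. The Cauchy-Schwarz inequality for the number of lines through a point yields
  $4l(q - 2)^2 \le (q^2 + q + 1 - 6l)(q + 4l - 6)$, which together with $6l \le q^2 + q + 1$ gives
  the bound on $l$.
\<close>

section \<open>Cauchy-Schwarz, counting and linear algebra\<close>

lemma sum_squared_le_card_sum_squares:
  fixes f :: "'b \<Rightarrow> real"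
  shows "(\<Sum>x\<in>A. f x)\<^sup>2 \<le> card A * (\<Sum>x\<in>A. (f x)\<^sup>2)"
proof -
  have "(\<Sum>x\<in>A. f x) \<le> L2_set f A * L2_set (\<lambda>_. 1) A" "- (\<Sum>x\<in>A. f x) \<le> L2_set f A * L2_set (\<lambda>_. 1) A"
    using L2_set_mult_ineq[of f "\<lambda>_. 1" A] sum_abs[of f A] by (simp_all add: abs_le_iff)
  then have "\<bar>\<Sum>x\<in>A. f x\<bar> \<le> L2_set f A * L2_set (\<lambda>_. 1) A" by linarith
  then have "(\<Sum>x\<in>A. f x)\<^sup>2 \<le> (L2_set f A * L2_set (\<lambda>_. 1) A)\<^sup>2"
    using abs_le_square_iff by fastforce
  then show ?thesis
    by (simp add: L2_set_def power_mult_distrib sum_nonneg mult.commute)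
qed

lemma card_supp_subset:
  "card {x :: 'a::{zero,finite} ^ 'n. supp x \<subseteq> A} = CARD('a) ^ card A"
proof -
  have "bij_betw (\<lambda>x. restrict (($) x) A) {x :: 'a ^ 'n. supp x \<subseteq> A} (A \<rightarrow>\<^sub>E UNIV)"
    by (rule bij_betw_byWitness[where f' = "\<lambda>f. \<chi> i. if i \<in> A then f i else 0"])
      (auto simp: supp_def vec_eq_iff fun_eq_iff PiE_def extensional_def split: if_splits)
  then show ?thesis
    by (simp add: bij_betw_same_card card_PiE)
qed

text \<open>Two distinct projective lines share at most one point, counted in vectors. An
  intersection not covered by the multiples of one of its vectors would contain two independent
  vectors, hence \<open>CARD('a)\<^sup>2\<close> elements, and would fill both \<open>U\<close> and
  \<open>W\<close>.\<close>

lemma card_subspace_Int_le: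
  fixes U W :: "('a::{field,finite} ^ 'm) set"
  assumes U: "vec.subspace U" "card U = CARD('a)\<^sup>2"
    and W: "vec.subspace W" "card W = CARD('a)\<^sup>2"
    and "U \<noteq> W"
  shows "card (U \<inter> W) \<le> CARD('a)"
proof (cases "\<exists>u\<in>U \<inter> W. U \<inter> W \<subseteq> range (\<lambda>c. c *s u)")
  case True
  then obtain u where "U \<inter> W \<subseteq> range (\<lambda>c. c *s u)" by blast
  then have "card (U \<inter> W) \<le> card (range (\<lambda>c. c *s u))" by (simp add: card_mono)
  also have "\<dots> \<le> CARD('a)" by (simp add: card_image_le)
  finally show ?thesis .
next
  case False
  have UW: "vec.subspace (U \<inter> W)" using U W by (simp add: vec.subspace_inter)
  have "\<not> U \<inter> W \<subseteq> range (\<lambda>c. c *s 0)" using False UW vec.subspace_0 by blast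
  then obtain u where u: "u \<in> U \<inter> W" "u \<noteq> 0" by auto
  obtain v where v: "v \<in> U \<inter> W" "v \<notin> range (\<lambda>c. c *s u)" using False u by blast
  have "inj (\<lambda>(a, b). a *s u + b *s v)"
  proof (rule injI, clarify)
    fix a b c d assume eq: "a *s u + b *s v = c *s u + d *s v"
    then have *: "(d - b) *s v = (a - c) *s u"
      by (simp add: vec.scale_left_diff_distrib algebra_simps)
    have "b = d"
    proof (rule ccontr)
      assume "b \<noteq> d"
      then have "v = inverse (d - b) *s ((d - b) *s v)"
        by (simp only: vec.scale_scale) simp
      then have "v = (inverse (d - b) * (a - c)) *s u"
        by (simp only: * vec.scale_scale)
      then show False using v by blast
    qed
    then show "a = c \<and> b = d" using eq u by simp
  qed
  then have "card (range (\<lambda>(a, b). a *s u + b *s v)) = CARD('a)\<^sup>2"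
    by (simp add: card_image power2_eq_square)
  moreover have "range (\<lambda>(a, b). a *s u + b *s v) \<subseteq> U \<inter> W"
    using u v vec.subspace_add[OF UW] vec.subspace_scale[OF UW] by force
  ultimately have "CARD('a)\<^sup>2 \<le> card (U \<inter> W)"
    by (metis card_mono finite)
  then have "U \<inter> W = U" "U \<inter> W = W"
    using U W by (simp_all add: card_subset_eq card_seteq)
  with \<open>U \<noteq> W\<close> show ?thesis by auto
qed

text \<open>A basis \<open>B\<close> of \<open>C\<close> is extended to a basis \<open>B'\<close> of
  \<open>D\<close>; the vectors of \<open>B\<close> go to 0, the remaining ones to distinct unit
  vectors. The dimension hypothesis is an inequality because
  \<open>dim_orthogonal_disjoint_supports_le\<close> provides an upper bound only.\<close>

lemma linear_map_with_small_kernel: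
  fixes C D :: "('a::field ^ 'n) set"
  assumes C: "vec.subspace C" and D: "vec.subspace D" and "C \<subseteq> D"
    and dim: "vec.dim D \<le> vec.dim C + CARD('m)"
  obtains \<phi> :: "'a ^ 'n \<Rightarrow> 'a ^ 'm"
  where "Vector_Spaces.linear (*s) (*s) \<phi>" "\<And>x. x \<in> D \<Longrightarrow> \<phi> x = 0 \<Longrightarrow> x \<in> C"
proof -
  obtain B where B: "B \<subseteq> C" "vec.independent B" "C \<subseteq> vec.span B" "card B = vec.dim C"
    using vec.basis_exists by blast
  obtain B' where B': "B \<subseteq> B'" "B' \<subseteq> D" "vec.independent B'" "D \<subseteq> vec.span B'"
    using vec.maximal_independent_subset_extend[of B D] B \<open>C \<subseteq> D\<close> by (metis subset_trans)
  have fin: "finite B'" using B' vec.finiteI_independent by blast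
  have "card B' = vec.dim D" using B' vec.basis_card_eq_dim by blast
  then have "card (B' - B) \<le> CARD('m)"
    using dim B B' fin by (simp add: card_Diff_subset finite_subset)
  then obtain f :: "'a ^ 'n \<Rightarrow> 'm" where f: "inj_on f (B' - B)"
    using fin card_le_inj[of "B' - B" "UNIV :: 'm set"] by auto
  obtain \<phi> :: "'a ^ 'n \<Rightarrow> 'a ^ 'm" where lin: "Vector_Spaces.linear (*s) (*s) \<phi>"
    and \<phi>: "\<forall>b\<in>B'. \<phi> b = (if b \<in> B then 0 else axis (f b) 1)"
    using vec.linear_independent_extend[OF B'(3), of "\<lambda>b. if b \<in> B then 0 else axis (f b) 1"] by auto
  interpret l: Vector_Spaces.linear "(*s)" "(*s)" \<phi> by (fact lin)
  have "x \<in> C" if "x \<in> D" "\<phi> x = 0" for x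
  proof -
    have "x \<in> vec.span B'" using that(1) B'(4) by blast
    then obtain u where x: "x = (\<Sum>b\<in>B'. u b *s b)"
      unfolding vec.span_finite[OF fin] by (elim rangeE)
    have "\<phi> x = (\<Sum>b\<in>B'. u b *s \<phi> b)" by (simp add: x l.sum l.scale)
    also have "\<dots> = (\<Sum>b\<in>B' - B. u b *s axis (f b) 1)"
      using fin \<phi> by (intro sum.mono_neutral_cong_right) auto
    finally have *: "(\<Sum>b\<in>B' - B. u b *s axis (f b) (1::'a)) = 0" using that by simp
    have u: "u b = 0" if "b \<in> B' - B" for b
    proof -
      \<comment> \<open>Since \<open>f\<close> is injective on \<open>B' - B\<close>, the coordinate
        \<open>f b\<close> isolates the coefficient \<open>u b\<close>.\<close>
      have "0 = (\<Sum>b'\<in>B' - B. u b' *s axis (f b') (1::'a)) $ f b" by (simp add: *)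
      also have "\<dots> = (\<Sum>b'\<in>B' - B. if b' = b then u b' else 0)"
        unfolding sum_component using f that
        by (intro sum.cong) (auto simp: axis_def inj_on_def)
      also have "\<dots> = u b" using that fin by (simp add: sum.delta)
      finally show ?thesis by simp
    qed
    have "x = (\<Sum>b\<in>B. u b *s b)"
      unfolding x using fin B' u by (intro sum.mono_neutral_cong_right) auto
    also have "\<dots> \<in> C"
      using B C by (intro vec.subspace_sum vec.subspace_scale) auto
    finally show ?thesis .
  qed
  with lin that show ?thesis by blast
qed

text \<open>With \<open>c\<close> the ceiling, k lies in (3c - 3, 3c], so k + c lies in (4c - 3,
  4c]. The only multiple of 4 there is 4c, which forces c = l - 1.\<close>

lemma dim_from_ceiling_equation:
  fixes k l :: nat
  assumes "int k + \<lceil>real k / 3\<rceil> = 4 * (int l - 1)"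
  shows "k + 3 = 3 * l"
proof -
  define c where "c = \<lceil>real k / 3\<rceil>"
  have "of_int c < real k / 3 + 1" "real k / 3 \<le> of_int c" unfolding c_def by linarith+
  then have "real_of_int c * 3 < real k + 3" "real k \<le> real_of_int c * 3" by linarith+
  then have "of_int (3 * c) < (of_int (int k + 3) :: real)" "of_int (int k) \<le> (of_int (3 * c) :: real)"
    by simp_all
  then have "3 * c < int k + 3" "int k \<le> 3 * c" unfolding of_int_less_iff of_int_le_iff .
  with assms show ?thesis unfolding c_def[symmetric] by presburger
qed


lemma subspace_orthogonal:
  fixes h :: "nat \<Rightarrow> 'a::field ^ 'n"
  shows "vec.subspace {x. \<forall>j<l. (\<Sum>i\<in>UNIV. h j $ i * x $ i) = 0}"
proof (rule vec.subspaceI)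
  fix x :: "'a ^ 'n" and c
  have "(\<Sum>i\<in>UNIV. h j $ i * (c *s x) $ i) = c * (\<Sum>i\<in>UNIV. h j $ i * x $ i)" for j
    by (simp add: sum_distrib_left mult.left_commute)
  moreover assume "x \<in> {x. \<forall>j<l. (\<Sum>i\<in>UNIV. h j $ i * x $ i) = 0}"
  ultimately show "c *s x \<in> {x. \<forall>j<l. (\<Sum>i\<in>UNIV. h j $ i * x $ i) = 0}" by simp
qed (simp_all add: distrib_left sum.distrib)

section \<open>Words local to a repair group and their images in 3-space\<close>

text \<open>Projective points and lines are handled as subspaces of dimension 1 and 2, and points are counted
  through their $q - 1$ nonzero vectors.\<close>

locale repair_groups =
  fixes h :: "nat \<Rightarrow> 'a::{field,finite} ^ 'n" and l :: nat and \<phi> :: "'a ^ 'n \<Rightarrow> 'a ^ 3"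
  assumes linear: "Vector_Spaces.linear (*s) (*s) \<phi>"
    and weight: "j < l \<Longrightarrow> card (supp (h j)) = 4"
    and disjoint: "disjoint_family_on (\<lambda>j. supp (h j)) {..<l}"
    and kernel: "\<lbrakk>\<And>j. j < l \<Longrightarrow> (\<Sum>i\<in>UNIV. h j $ i * x $ i) = 0; \<phi> x = 0; card (supp x) \<le> 5\<rbrakk> \<Longrightarrow> x = 0"
begin

sublocale \<phi>: Vector_Spaces.linear "(*s)" "(*s)" \<phi>
  by (fact linear)

definition local_words :: "'n set \<Rightarrow> ('a ^ 'n) set" where
  "local_words S = {x. supp x \<subseteq> S \<and> (\<forall>j<l. (\<Sum>i\<in>UNIV. h j $ i * x $ i) = 0)}"

text \<open>For \<open>S\<close> in \<open>blocks 2\<close> this is a vertex of a quadrilateral, for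
  \<open>S\<close> in \<open>blocks 3\<close> one of its lines, in both cases including the zero
  vector.\<close>

definition flat :: "'n set \<Rightarrow> ('a ^ 3) set" where
  "flat S = \<phi> ` local_words S"

definition blocks :: "nat \<Rightarrow> 'n set set" where
  "blocks k = (\<Union>j<l. {S. S \<subseteq> supp (h j) \<and> card S = k})"

lemma subspace_local_words: "vec.subspace (local_words S)"
proof -
  have "local_words S =
      {x. \<forall>i. i \<notin> S \<longrightarrow> x $ i = 0} \<inter> {x. \<forall>j<l. (\<Sum>i\<in>UNIV. h j $ i * x $ i) = 0}"
    by (auto simp: local_words_def supp_def)
  moreover have "vec.subspace {x :: 'a ^ 'n. \<forall>i. i \<notin> S \<longrightarrow> x $ i = 0}"
    by (rule vec.subspaceI) simp_all
  ultimately show ?thesis by (simp add: vec.subspace_inter subspace_orthogonal)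
qed

lemma subspace_flat: "vec.subspace (flat S)"
  unfolding flat_def by (rule \<phi>.subspace_image[OF subspace_local_words])

lemma zero_in_flat: "0 \<in> flat S"
  using subspace_flat vec.subspace_0 by blast

lemma flat_mono: "S \<subseteq> T \<Longrightarrow> flat S \<subseteq> flat T"
  by (auto simp: flat_def local_words_def)

text \<open>The difference of the two words passes all repair checks, is killed by
  \<open>\<phi>\<close> and has weight at most 5 = d - 1, so \<open>kernel\<close> applies.\<close>

lemma local_words_eqI:
  assumes "x \<in> local_words S" "y \<in> local_words T" "card (S \<union> T) \<le> 5" "\<phi> x = \<phi> y"
  shows "x = y"
proof -
  have "supp (x - y) \<subseteq> supp x \<union> supp y" by (auto simp: supp_def)
  also have "\<dots> \<subseteq> S \<union> T" using assms by (auto simp: local_words_def)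
  finally have "supp (x - y) \<subseteq> S \<union> T" .
  then have "card (supp (x - y)) \<le> 5" using assms(3) card_mono[of "S \<union> T" "supp (x - y)"] by simp
  moreover have "(\<Sum>i\<in>UNIV. h j $ i * (x - y) $ i) = 0" if "j < l" for j
    using assms that by (simp add: local_words_def algebra_simps sum_subtractf)
  ultimately have "x - y = 0" using assms(4) by (intro kernel) (auto simp: \<phi>.diff)
  then show ?thesis by simp
qed

text \<open>This turns incidence geometry into set intersection: a common image has a single
  preimage, and its support lies in both \<open>S\<close> and \<open>T\<close>.\<close>

lemma flat_Int:
  assumes "card (S \<union> T) \<le> 5"
  shows "flat S \<inter> flat T = flat (S \<inter> T)"
proof
  show "flat S \<inter> flat T \<subseteq> flat (S \<inter> T)"
  proof
    fix v assume "v \<in> flat S \<inter> flat T"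
    then obtain x y where "x \<in> local_words S" "y \<in> local_words T" "v = \<phi> x" "v = \<phi> y"
      by (auto simp: flat_def)
    moreover from this have "x = y" using local_words_eqI assms by auto
    ultimately show "v \<in> flat (S \<inter> T)" by (auto simp: flat_def local_words_def)
  qed
qed (auto intro: subsetD[OF flat_mono])

text \<open>The supports of the other repair words miss \<open>S\<close>, so \<open>h j\<close> is
  the only effective check. Its coefficient at a chosen \<open>a\<close> in \<open>S\<close> is
  nonzero; hence the entry at \<open>a\<close> is determined by the others, which are free.\<close>

lemma card_local_words:
  assumes j: "j < l" and S: "S \<subseteq> supp (h j)" "S \<noteq> {}"
  shows "card (local_words S) = CARD('a) ^ (card S - 1)"
proof -
  obtain a where a: "a \<in> S" using S by blast
  then have ha: "h j $ a \<noteq> 0" using S by (auto simp: supp_def)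
  have sum_j: "(\<Sum>i\<in>UNIV. h j $ i * x $ i) = h j $ a * x $ a + (\<Sum>i\<in>UNIV - {a}. h j $ i * x $ i)"
    for x :: "'a ^ 'n" by (simp add: sum.remove[of UNIV a])
  have local: "x \<in> local_words S \<longleftrightarrow> supp x \<subseteq> S \<and> (\<Sum>i\<in>UNIV. h j $ i * x $ i) = 0" for x
  proof -
    have "(\<Sum>i\<in>UNIV. h j' $ i * x $ i) = 0" if "supp x \<subseteq> S" "j' < l" "j' \<noteq> j" for j'
    proof -
      have "supp (h j') \<inter> supp (h j) = {}"
        using disjoint that j by (auto simp: disjoint_family_on_def)
      then show ?thesis using that S by (intro sum.neutral) (auto simp: supp_def)
    qed
    then show ?thesis using j by (auto simp: local_words_def)
  qed
  let ?f = "\<lambda>x :: 'a ^ 'n. \<chi> i. if i = a then 0 else x $ i"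
  let ?g = "\<lambda>x :: 'a ^ 'n. \<chi> i. if i = a then - (\<Sum>i\<in>UNIV - {a}. h j $ i * x $ i) / h j $ a else x $ i"
  have "bij_betw ?f (local_words S) {x. supp x \<subseteq> S - {a}}"
  proof (rule bij_betw_byWitness[where f' = ?g])
    show "\<forall>x\<in>local_words S. ?g (?f x) = x"
    proof
      fix x assume "x \<in> local_words S"
      then have "h j $ a * x $ a + (\<Sum>i\<in>UNIV - {a}. h j $ i * x $ i) = 0"
        using local sum_j by simp
      then have "x $ a = - (\<Sum>i\<in>UNIV - {a}. h j $ i * x $ i) / h j $ a"
        using ha by (simp add: field_simps add_eq_0_iff)
      then show "?g (?f x) = x" by (simp add: vec_eq_iff)
    qed
    show "\<forall>x\<in>{x. supp x \<subseteq> S - {a}}. ?f (?g x) = x"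
      by (auto simp: vec_eq_iff supp_def)
    show "?f ` local_words S \<subseteq> {x. supp x \<subseteq> S - {a}}"
      by (auto simp: local_words_def supp_def split: if_splits)
    show "?g ` {x. supp x \<subseteq> S - {a}} \<subseteq> local_words S"
    proof (clarify, unfold local, intro conjI)
      fix x :: "'a ^ 'n" assume "supp x \<subseteq> S - {a}"
      then show "supp (?g x) \<subseteq> S" using a by (auto simp: supp_def split: if_splits)
      show "(\<Sum>i\<in>UNIV. h j $ i * ?g x $ i) = 0"
        unfolding sum_j using ha by simp
    qed
  qed
  then have "card (local_words S) = card {x :: 'a ^ 'n. supp x \<subseteq> S - {a}}"
    by (rule bij_betw_same_card)
  then show ?thesis using a by (simp add: card_supp_subset)
qed

lemma card_flat:
  assumes "S \<in> blocks k" "0 < k"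
  shows "card (flat S) = CARD('a) ^ (k - 1)"
proof -
  obtain j where j: "j < l" "S \<subseteq> supp (h j)" "card S = k" using assms by (auto simp: blocks_def)
  then have "card S \<le> 4" using card_mono[OF _ j(2)] weight by simp
  then have "inj_on \<phi> (local_words S)" by (intro inj_onI local_words_eqI[where S=S and T=S]) auto
  then have "card (flat S) = card (local_words S)" unfolding flat_def by (rule card_image)
  then show ?thesis using card_local_words[OF j(1,2)] j(3) assms(2) by fastforce
qed

text \<open>On a single coordinate of a repair group the check of that group already forces the
  entry to be 0.\<close>

lemma flat_trivial:
  assumes "S \<in> blocks k" "A \<subseteq> S" "card A \<le> 1"
  shows "flat A = {0}"
proof (cases "A = {}")
  case True
  have "x = 0" if "supp x = {}" for x :: "'a ^ 'n"
    using that by (simp add: supp_def vec_eq_iff)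
  then have "local_words A \<subseteq> {0}" using True by (auto simp: local_words_def)
  then have "flat A \<subseteq> {0}" by (auto simp: flat_def)
  then show ?thesis using zero_in_flat by blast
next
  case False
  then have "card A = 1" using assms(3) by (simp add: card_gt_0_iff le_antisym Suc_leI)
  moreover from this have "A \<in> blocks 1" using assms by (auto simp: blocks_def)
  ultimately have "card (flat A) = 1" using card_flat by fastforce
  then show ?thesis using zero_in_flat[of A] by (auto simp: card_1_singleton_iff)
qed

lemma disjoint_blocks:
  assumes "i < l" "j < l" "i \<noteq> j" "S \<subseteq> supp (h i)" "T \<subseteq> supp (h j)"
  shows "S \<inter> T = {}"
proof -
  have "supp (h i) \<inter> supp (h j) = {}"
    using disjoint assms(1-3) by (simp add: disjoint_family_on_def)
  then show ?thesis using assms(4,5) by blast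
qed

lemma card_blocks:
  assumes "0 < k"
  shows "card (blocks k) = l * (4 choose k)"
proof -
  have "card (blocks k) = (\<Sum>j<l. card {S. S \<subseteq> supp (h j) \<and> card S = k})"
    unfolding blocks_def
  proof (intro card_UN_disjoint ballI impI)
    fix i j assume "i \<in> {..<l}" "j \<in> {..<l}" "i \<noteq> j"
    then have *: "supp (h i) \<inter> supp (h j) = {}"
      using disjoint_blocks[of i j "supp (h i)" "supp (h j)"] by simp
    have "card S \<noteq> k" if "S \<subseteq> supp (h i)" "S \<subseteq> supp (h j)" for S
    proof -
      have "S = {}" using * that by (metis Int_greatest subset_empty)
      then show ?thesis using assms by simp
    qed
    then show "{S. S \<subseteq> supp (h i) \<and> card S = k} \<inter> {S. S \<subseteq> supp (h j) \<and> card S = k} = {}"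
      by blast
  qed auto
  also have "\<dots> = l * (4 choose k)" by (simp add: n_subsets weight)
  finally show ?thesis .
qed

text \<open>The bound 2 + 3 = 5 on \<open>card (P \<union> S)\<close> is exactly what minimum
  distance 6 permits. The case \<open>k = 2\<close> separates the vertices; the case
  \<open>k = 3\<close> says that a vertex lies only on lines whose triple contains its pair.\<close>

lemma flat_pair_Int:
  assumes P: "P \<in> blocks 2" and S: "S \<in> blocks k" "k \<in> {2, 3}" and "\<not> P \<subseteq> S"
  shows "flat P \<inter> flat S = {0}"
proof -
  have c: "card P = 2" "card S = k" using P S by (auto simp: blocks_def)
  have "card (P \<inter> S) < card P" using \<open>\<not> P \<subseteq> S\<close> by (intro psubset_card_mono) auto
  then have "flat (P \<inter> S) = {0}" using flat_trivial[OF P, of "P \<inter> S"] c by simp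
  moreover have "card (P \<union> S) \<le> 5" using card_Un_le[of P S] c S by auto
  ultimately show ?thesis by (simp add: flat_Int)
qed

section \<open>Vertices, remaining points and their counts\<close>

definition vertices :: "('a ^ 3) set" where
  "vertices = (\<Union>P\<in>blocks 2. flat P - {0})"

lemma card_flat_diff_zero:
  assumes "S \<in> blocks k" "0 < k"
  shows "card (flat S - {0}) = CARD('a) ^ (k - 1) - 1"
  using card_flat[OF assms] zero_in_flat by (simp add: card_Diff_singleton)

lemma disjoint_flat_pairs:
  "disjoint_family_on (\<lambda>P. flat P - {0}) (blocks 2)"
  unfolding disjoint_family_on_def
proof (intro ballI impI)
  fix P Q assume PQ: "P \<in> blocks 2" "Q \<in> blocks 2" "P \<noteq> Q"
  then have "card P = card Q" by (auto simp: blocks_def)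
  then have "\<not> P \<subseteq> Q" using PQ(3) card_subset_eq[of Q P] by auto
  then show "(flat P - {0}) \<inter> (flat Q - {0}) = {}"
    using flat_pair_Int[OF PQ(1,2)] by auto
qed

lemma card_UN_flat_pairs:
  assumes "\<P> \<subseteq> blocks 2"
  shows "card (\<Union>P\<in>\<P>. flat P - {0}) = card \<P> * (CARD('a) - 1)"
proof -
  have "card (\<Union>P\<in>\<P>. flat P - {0}) = (\<Sum>P\<in>\<P>. card (flat P - {0}))"
    using disjoint_flat_pairs assms
    by (intro card_UN_disjoint) (auto simp: disjoint_family_on_def subset_iff)
  also have "\<dots> = (\<Sum>P\<in>\<P>. CARD('a) - 1)"
    using assms card_flat_diff_zero[of _ 2] by (intro sum.cong) auto
  finally show ?thesis by simp
qed

lemma card_vertices: "card vertices = 6 * l * (CARD('a) - 1)"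
  unfolding vertices_def using card_UN_flat_pairs[of "blocks 2"] card_blocks[of 2]
  by (simp add: choose_two)

definition others :: "('a ^ 3) set" where
  "others = - insert 0 vertices"

text \<open>Division by \<open>CARD('a) - 1\<close> gives the q^2 + q + 1 - 6l remaining points of
  the plane.\<close>

lemma card_others: "card others + 6 * l * (CARD('a) - 1) = CARD('a) ^ 3 - 1"
proof -
  have "0 \<notin> vertices" by (auto simp: vertices_def)
  then have "card (insert 0 vertices) = Suc (6 * l * (CARD('a) - 1))" by (simp add: card_vertices)
  moreover have "card others + card (insert 0 vertices) = CARD('a ^ 3)"
    unfolding others_def by (subst card_Un_disjoint[symmetric]) (auto simp only: Compl_partition2 finite)
  moreover have "CARD('a ^ 3) = CARD('a) ^ 3" unfolding CARD_vec by simp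
  ultimately show ?thesis by simp
qed

lemma flat_triple_Int_vertices:
  assumes "T \<in> blocks 3"
  shows "flat T \<inter> vertices = (\<Union>P\<in>{P. P \<subseteq> T \<and> card P = 2}. flat P - {0})"
proof
  show "flat T \<inter> vertices \<subseteq> (\<Union>P\<in>{P. P \<subseteq> T \<and> card P = 2}. flat P - {0})"
  proof
    fix v assume v: "v \<in> flat T \<inter> vertices"
    then obtain P where P: "P \<in> blocks 2" "v \<in> flat P - {0}" by (auto simp: vertices_def)
    then have "P \<subseteq> T" using flat_pair_Int[OF P(1) assms] v by blast
    then show "v \<in> (\<Union>P\<in>{P. P \<subseteq> T \<and> card P = 2}. flat P - {0})"
      using P by (auto simp: blocks_def)
  qed
  show "(\<Union>P\<in>{P. P \<subseteq> T \<and> card P = 2}. flat P - {0}) \<subseteq> flat T \<inter> vertices"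
  proof
    fix v assume "v \<in> (\<Union>P\<in>{P. P \<subseteq> T \<and> card P = 2}. flat P - {0})"
    then obtain P where P: "P \<subseteq> T" "card P = 2" "v \<in> flat P - {0}" by blast
    then have "P \<in> blocks 2" using assms by (auto simp: blocks_def)
    with P show "v \<in> flat T \<inter> vertices"
      using flat_mono[OF P(1)] unfolding vertices_def by blast
  qed
qed

text \<open>A line has q + 1 points, and exactly three of them are vertices, one for each pair in
  \<open>T\<close>. Each of the q - 2 others contributes q - 1 vectors.\<close>

lemma card_flat_triple_others:
  assumes "T \<in> blocks 3"
  shows "real (card (flat T \<inter> others)) = (real CARD('a) - 1) * (real CARD('a) - 2)"
proof -
  let ?q = "CARD('a)"
  let ?\<P> = "{P. P \<subseteq> T \<and> card P = 2}"
  have "card T = 3" using assms by (auto simp: blocks_def)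
  then have "card ?\<P> = 3" by (simp add: n_subsets choose_two)
  moreover have "?\<P> \<subseteq> blocks 2" using assms by (auto simp: blocks_def)
  ultimately have v: "card (flat T \<inter> vertices) = 3 * (?q - 1)"
    unfolding flat_triple_Int_vertices[OF assms] by (simp only: card_UN_flat_pairs)
  have "flat T - {0} = (flat T \<inter> vertices) \<union> (flat T \<inter> others)"
    by (auto simp: others_def vertices_def)
  moreover have "(flat T \<inter> vertices) \<inter> (flat T \<inter> others) = {}"
    by (auto simp: others_def)
  ultimately have "card (flat T - {0}) = 3 * (?q - 1) + card (flat T \<inter> others)"
    by (simp add: card_Un_disjoint v)
  then have "?q\<^sup>2 - 1 = 3 * (?q - 1) + card (flat T \<inter> others)"
    using card_flat_diff_zero[OF assms] by simp
  then have "real (?q\<^sup>2 - 1) = real (3 * (?q - 1) + card (flat T \<inter> others))" by (rule arg_cong)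
  moreover have "1 \<le> ?q" by (simp add: Suc_leI)
  moreover from this have "1 \<le> ?q\<^sup>2" by simp
  ultimately have "real ?q ^ 2 - 1 = 3 * (real ?q - 1) + card (flat T \<inter> others)"
    by (simp add: of_nat_diff)
  then show ?thesis by (simp add: algebra_simps power2_eq_square)
qed

section \<open>Intersections of lines and the incidence count\<close>

text \<open>Two distinct triples among four coordinates meet in a pair, so their lines meet in a
  vertex, and vertices are excluded from \<open>others\<close>.\<close>

lemma flat_triples_same_group:
  assumes "j < l" "S \<subseteq> supp (h j)" "T \<subseteq> supp (h j)" "card S = 3" "card T = 3" "S \<noteq> T"
  shows "flat S \<inter> flat T \<inter> others = {}"
proof -
  have "S \<union> T \<subseteq> supp (h j)" using assms by simp
  then have u: "card (S \<union> T) \<le> 4" using card_mono[of "supp (h j)" "S \<union> T"] assms weight by simp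
  have "card (S \<inter> T) + card (S \<union> T) = 6" using card_Un_Int[of S T] assms by simp
  moreover have "card (S \<inter> T) < card S"
    using assms card_subset_eq[of T S] by (intro psubset_card_mono) auto
  ultimately have "card (S \<inter> T) = 2" using u assms by simp
  then have "S \<inter> T \<in> blocks 2" using assms by (auto simp: blocks_def)
  then show ?thesis using flat_Int[of S T] u by (auto simp: others_def vertices_def)
qed

text \<open>The lines differ because a vertex of the first does not lie on the second; distinct
  lines share at most one point, that is q - 1 nonzero vectors.\<close>

lemma flat_triples_different_groups:
  assumes "i < l" "j < l" "i \<noteq> j" "S \<subseteq> supp (h i)" "T \<subseteq> supp (h j)" "card S = 3" "card T = 3"
  shows "card (flat S \<inter> flat T \<inter> others) \<le> CARD('a) - 1"
proof -
  have S: "S \<in> blocks 3" and T: "T \<in> blocks 3" using assms by (auto simp: blocks_def)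
  obtain P where P: "P \<subseteq> S" "card P = 2"
    using obtain_subset_with_card_n[of 2 S] assms by auto
  have P2: "P \<in> blocks 2" using P S by (auto simp: blocks_def)
  have "S \<inter> T = {}" using disjoint_blocks assms by blast
  then have "\<not> P \<subseteq> T" using P by (metis Int_greatest card.empty subset_empty zero_neq_numeral)
  then have "flat P \<inter> flat T = {0}" using flat_pair_Int[OF P2 T] by simp
  \<comment> \<open>This makes the vertex \<open>flat P\<close> contain a nonzero vector, which
    tells the two lines apart.\<close>
  moreover have "CARD('a) \<ge> 2" using card_mono[of UNIV "{0, 1 :: 'a}"] by simp
  then have "card (flat P) \<noteq> card {0 :: 'a ^ 3}" using card_flat[OF P2] by simp
  then have "flat P \<noteq> {0}" by metis
  ultimately have "flat S \<noteq> flat T" using flat_mono[OF P(1)] by blast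
  then have "card (flat S \<inter> flat T) \<le> CARD('a)"
    using card_flat[OF S] card_flat[OF T] subspace_flat by (intro card_subspace_Int_le) auto
  moreover have "card (flat S \<inter> flat T \<inter> others) \<le> card (flat S \<inter> flat T - {0})"
    by (rule card_mono) (auto simp: others_def)
  ultimately show ?thesis using zero_in_flat by (simp add: card_Diff_singleton)
qed

text \<open>The triple \<open>T\<close> itself contributes (q - 1)(q - 2), the three others of its
  group nothing, and each of the 4l - 4 triples of other groups at most q - 1.\<close>

lemma sum_card_flat_Int:
  assumes "T \<in> blocks 3"
  shows "(\<Sum>S\<in>blocks 3. real (card (flat S \<inter> flat T \<inter> others)))
    \<le> (real CARD('a) - 1) * (real CARD('a) + 4 * real l - 6)"
proof -
  let ?q = "real CARD('a)"
  obtain j where j: "j < l" "T \<subseteq> supp (h j)" "card T = 3" using assms by (auto simp: blocks_def)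
  let ?G = "{S. S \<subseteq> supp (h j) \<and> card S = 3}"
  let ?f = "\<lambda>S. real (card (flat S \<inter> flat T \<inter> others))"
  have G: "?G \<subseteq> blocks 3" using j by (auto simp: blocks_def)
  have cG: "card ?G = 4" using j weight by (simp add: n_subsets numeral_3_eq_3 numeral_eq_Suc)
  have cb: "card (blocks 3) = 4 * l" by (simp add: card_blocks numeral_eq_Suc)
  have fin: "finite (blocks 3)" by simp
  have "(\<Sum>S\<in>?G. ?f S) = (\<Sum>S\<in>{T}. ?f S)"
    using j flat_triples_same_group by (intro sum.mono_neutral_right) auto
  also have "\<dots> = (?q - 1) * (?q - 2)" using card_flat_triple_others[OF assms] by simp
  finally have 1: "(\<Sum>S\<in>?G. ?f S) = (?q - 1) * (?q - 2)" .
  have "(\<Sum>S\<in>blocks 3 - ?G. ?f S) \<le> (\<Sum>S\<in>blocks 3 - ?G. ?q - 1)"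
  proof (rule sum_mono)
    fix S assume "S \<in> blocks 3 - ?G"
    then obtain i where "i < l" "i \<noteq> j" "S \<subseteq> supp (h i)" "card S = 3" by (auto simp: blocks_def)
    then have "card (flat S \<inter> flat T \<inter> others) \<le> CARD('a) - 1"
      using flat_triples_different_groups j by blast
    then have "?f S \<le> real (CARD('a) - 1)" by (rule of_nat_mono)
    then show "?f S \<le> ?q - 1" by (simp add: of_nat_diff Suc_leI)
  qed
  also have "\<dots> = (4 * real l - 4) * (?q - 1)"
    using j G cG cb fin by (simp add: card_Diff_subset of_nat_diff)
  finally have 2: "(\<Sum>S\<in>blocks 3 - ?G. ?f S) \<le> (4 * real l - 4) * (?q - 1)" .
  have "(\<Sum>S\<in>blocks 3. ?f S) = (\<Sum>S\<in>blocks 3 - ?G. ?f S) + (\<Sum>S\<in>?G. ?f S)"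
    by (rule sum.subset_diff[OF G fin])
  also have "\<dots> \<le> (4 * real l - 4) * (?q - 1) + (?q - 1) * (?q - 2)" using 1 2 by simp
  finally show ?thesis by (simp add: algebra_simps)
qed

lemma incidence_inequality:
  fixes q :: real
  defines "q \<equiv> real CARD('a)"
  assumes "0 < l"
  shows "4 * l * (q - 2)\<^sup>2 \<le> (q\<^sup>2 + q + 1 - 6 * l) * (q + 4 * l - 6)"
    and "6 * l \<le> q\<^sup>2 + q + 1"
proof -
  \<comment> \<open>The number of lines through \<open>v\<close>: its first moment over
    \<open>others\<close> counts incidences, its second moment ordered pairs of lines through a
    common vector.\<close>
  define d where "d v = (\<Sum>T\<in>blocks 3. of_bool (v \<in> flat T) :: real)" for v
  have q: "q \<ge> 2" using card_mono[of UNIV "{0, 1 :: 'a}"] by (simp add: q_def)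
  have cb: "card (blocks 3) = 4 * l" by (simp add: card_blocks numeral_eq_Suc)
  have X: "real (card others) = (q - 1) * (q\<^sup>2 + q + 1 - 6 * l)"
  proof -
    have "1 \<le> CARD('a)" by (simp add: Suc_leI)
    moreover from this have "1 \<le> CARD('a) ^ 3" by simp
    moreover have "real (card others + 6 * l * (CARD('a) - 1)) = real (CARD('a) ^ 3 - 1)"
      using card_others by simp
    ultimately have "real (card others) = q ^ 3 - 1 - 6 * l * (q - 1)"
      by (simp add: of_nat_diff q_def)
    then show ?thesis by (simp add: algebra_simps power2_eq_square power3_eq_cube)
  qed
  have "0 \<le> (q - 1) * (q\<^sup>2 + q + 1 - 6 * l)" unfolding X[symmetric] by simp
  then show "6 * l \<le> q\<^sup>2 + q + 1" using q by (simp add: zero_le_mult_iff)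
  have d1: "(\<Sum>v\<in>others. d v) = 4 * l * ((q - 1) * (q - 2))"
  proof -
    have "(\<Sum>v\<in>others. d v) = (\<Sum>T\<in>blocks 3. \<Sum>v\<in>others. of_bool (v \<in> flat T))"
      unfolding d_def by (rule sum.swap)
    also have "\<dots> = (\<Sum>T\<in>blocks 3. (q - 1) * (q - 2))"
    proof (rule sum.cong)
      fix T assume "T \<in> blocks 3"
      then show "(\<Sum>v\<in>others. of_bool (v \<in> flat T)) = (q - 1) * (q - 2)"
        using card_flat_triple_others by (simp add: q_def Int_commute)
    qed simp
    finally show ?thesis using cb by simp
  qed
  have d2: "(\<Sum>v\<in>others. (d v)\<^sup>2) \<le> 4 * l * ((q - 1) * (q + 4 * l - 6))"
  proof -
    have "(\<Sum>v\<in>others. (d v)\<^sup>2) = (\<Sum>v\<in>others. \<Sum>T\<in>blocks 3. \<Sum>S\<in>blocks 3. of_bool (v \<in> flat S \<inter> flat T))"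
      unfolding d_def power2_eq_square sum_product by (simp add: conj_commute flip: of_bool_conj)
    also have "\<dots> = (\<Sum>T\<in>blocks 3. \<Sum>v\<in>others. \<Sum>S\<in>blocks 3. of_bool (v \<in> flat S \<inter> flat T))"
      by (rule sum.swap)
    also have "\<dots> = (\<Sum>T\<in>blocks 3. \<Sum>S\<in>blocks 3. \<Sum>v\<in>others. of_bool (v \<in> flat S \<inter> flat T))"
      by (intro sum.cong refl sum.swap)
    also have "\<dots> = (\<Sum>T\<in>blocks 3. \<Sum>S\<in>blocks 3. real (card (flat S \<inter> flat T \<inter> others)))"
      by (intro sum.cong refl) (simp add: Int_ac Collect_conj_eq)
    also have "\<dots> \<le> (\<Sum>T\<in>blocks 3. (q - 1) * (q + 4 * l - 6))"
      using sum_card_flat_Int unfolding q_def by (intro sum_mono) auto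
    finally show ?thesis using cb by simp
  qed
  \<comment> \<open>The factor common to both sides of Cauchy-Schwarz: (q - 1)^2 comes from counting
    vectors instead of points, 4l from the number of lines.\<close>
  let ?c = "4 * l * (q - 1)\<^sup>2"
  have c: "?c > 0" using assms q by simp
  have "?c * (4 * l * (q - 2)\<^sup>2) = (\<Sum>v\<in>others. d v)\<^sup>2"
    by (simp add: d1 power_mult_distrib power2_eq_square)
  also have "\<dots> \<le> card others * (\<Sum>v\<in>others. (d v)\<^sup>2)"
    by (rule sum_squared_le_card_sum_squares)
  also have "\<dots> \<le> card others * (4 * l * ((q - 1) * (q + 4 * l - 6)))"
    by (intro mult_left_mono d2) simp
  also have "\<dots> = ?c * ((q\<^sup>2 + q + 1 - 6 * l) * (q + 4 * l - 6))"
    by (simp add: X power2_eq_square)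
  finally show "4 * l * (q - 2)\<^sup>2 \<le> (q\<^sup>2 + q + 1 - 6 * l) * (q + 4 * l - 6)"
    using c by (simp only: mult_le_cancel_left_pos)
qed

lemma number_of_groups_bound:
  fixes q :: real
  defines "q \<equiv> real CARD('a)"
  assumes "0 < l"
  shows "int l \<le> \<lfloor>(7 * q + 3 + sqrt (24 * q ^ 3 + q ^ 2 - 6 * q - 63)) / 24\<rfloor>"
proof -
  have "4 * l * (q - 2)\<^sup>2 \<le> (q\<^sup>2 + q + 1 - 6 * l) * (q + 4 * l - 6)" "6 * l \<le> q\<^sup>2 + q + 1"
    using incidence_inequality[OF \<open>0 < l\<close>] by (simp_all add: q_def)
  \<comment> \<open>This is 24 times the first inequality plus 72 times the second, with the square
    in \<open>l\<close> completed.\<close>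
  then have "(24 * real l - 7 * q - 3)\<^sup>2 \<le> 24 * q ^ 3 + q ^ 2 - 6 * q - 63"
    by (simp add: algebra_simps power2_eq_square power3_eq_cube)
  then have "24 * real l - 7 * q - 3 \<le> sqrt (24 * q ^ 3 + q ^ 2 - 6 * q - 63)"
    by (rule real_le_rsqrt)
  then show ?thesis by (simp add: le_floor_iff field_simps)
qed

end

section \<open>Growth of the bound, and passage from the code to the plane\<close>

lemma length_bound_bigo:
  "(\<lambda>m::nat. real_of_int
      (4 * \<lfloor>(7 * real m + 3 + sqrt (24 * real m ^ 3 + real m ^ 2 - 6 * real m - 63)) / 24\<rfloor>))
    \<in> O(\<lambda>m. real m powr (3 / 2))"
  (is "(\<lambda>m. real_of_int (4 * \<lfloor>?g m\<rfloor>)) \<in> _")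
proof -
  have *: "\<bar>real_of_int (4 * \<lfloor>x\<rfloor>)\<bar> \<le> 4 * \<bar>\<bar>x\<bar> + 1\<bar>" for x :: real
    by (auto simp: abs_if; linarith)
  have "(\<lambda>m. real_of_int (4 * \<lfloor>?g m\<rfloor>)) \<in> O(\<lambda>m. \<bar>?g m\<bar> + 1)"
    by (intro bigoI[where c = 4] always_eventually allI) (simp only: real_norm_def *)
  also have "(\<lambda>m. \<bar>?g m\<bar> + 1) \<in> O(\<lambda>m. real m powr (3 / 2))" by real_asymp
  finally show ?thesis .
qed

text \<open>One pivot coordinate \<open>p j\<close> is chosen in each support. On a word supported
  on the pivots, each check sees only its own pivot, so such a word passing all checks is 0. Thus
  the solution space meets the \<open>l\<close>-dimensional space \<open>?E\<close>
  trivially.\<close>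

lemma dim_orthogonal_disjoint_supports_le:
  fixes h :: "nat \<Rightarrow> 'a::field ^ 'n"
  assumes disj: "disjoint_family_on (\<lambda>j. supp (h j)) {..<l}"
    and nonzero: "\<And>j. j < l \<Longrightarrow> supp (h j) \<noteq> {}"
  shows "vec.dim {x. \<forall>j<l. (\<Sum>i\<in>UNIV. h j $ i * x $ i) = 0} + l \<le> CARD('n)"
proof -
  let ?D = "{x :: 'a ^ 'n. \<forall>j<l. (\<Sum>i\<in>UNIV. h j $ i * x $ i) = 0}"
  have "\<forall>j\<in>{..<l}. \<exists>i. i \<in> supp (h j)" using nonzero by blast
  then obtain p where p: "\<forall>j\<in>{..<l}. p j \<in> supp (h j)" by (rule bchoice[THEN exE])
  let ?E = "{x :: 'a ^ 'n. \<forall>i. i \<notin> p ` {..<l} \<longrightarrow> x $ i = 0}"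
  have "inj_on p {..<l}"
    using p disj by (force simp: inj_on_def disjoint_family_on_def)
  then have E: "vec.dim ?E = l" unfolding dim_substandard_cart by (simp add: card_image)
  have "x = 0" if "x \<in> ?D" "x \<in> ?E" for x
  proof -
    have "x $ p j = 0" if j: "j < l" for j
    proof -
      have "h j $ i * x $ i = 0" if "i \<noteq> p j" for i
      proof (cases "i \<in> p ` {..<l}")
        case True
        then obtain k where k: "k < l" "i = p k" by auto
        then have "k \<noteq> j" using that by blast
        then have "supp (h k) \<inter> supp (h j) = {}"
          using disj j k(1) by (simp add: disjoint_family_on_def)
        moreover have "i \<in> supp (h k)" using k p by simp
        ultimately have "h j $ i = 0" unfolding supp_def by blast
        then show ?thesis by simp
      next
        case False
        then show ?thesis using \<open>x \<in> ?E\<close> by simp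
      qed
      then have "(\<Sum>i\<in>UNIV - {p j}. h j $ i * x $ i) = 0"
        by (intro sum.neutral) blast
      then have "(\<Sum>i\<in>UNIV. h j $ i * x $ i) = h j $ p j * x $ p j"
        by (simp add: sum.remove[of UNIV "p j"])
      moreover have "(\<Sum>i\<in>UNIV. h j $ i * x $ i) = 0" using \<open>x \<in> ?D\<close> j by simp
      moreover have "h j $ p j \<noteq> 0" using p j by (simp add: supp_def)
      ultimately show ?thesis by simp
    qed
    then have "x $ i = 0" for i
      using \<open>x \<in> ?E\<close> by (cases "i \<in> p ` {..<l}") auto
    then show ?thesis by (simp add: vec_eq_iff)
  qed
  then have "?D \<inter> ?E \<subseteq> {0}" by (intro subsetI) (elim IntE, simp only: singleton_iff)
  then have "vec.dim (?D \<inter> ?E) = 0" by (simp only: vec.dim_eq_0)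
  moreover have "vec.subspace ?D" by (rule subspace_orthogonal)
  moreover have "vec.subspace ?E" by (rule vec.subspaceI) simp_all
  ultimately have "vec.dim {x + y |x y. x \<in> ?D \<and> y \<in> ?E} = vec.dim ?D + l"
    using vec.dim_sums_Int[of ?D ?E] E by linarith
  moreover have "vec.dim {x + y |x y. x \<in> ?D \<and> y \<in> ?E} \<le> CARD('n)"
    by (rule dim_subset_UNIV_cart_gen)
  ultimately show ?thesis by linarith
qed

lemma weight_ge_min_distance:
  fixes C :: "('a::{field,finite} ^ 'n) set"
  assumes "vec.subspace C" "x \<in> C" "x \<noteq> 0"
  shows "min_distance C \<le> hamming_weight x"
proof -
  have "hamming_weight x = hamming_dist x 0"
    by (simp add: hamming_weight_def hamming_dist_def supp_def)
  moreover have "hamming_dist x 0 \<in> {hamming_dist x y |x y. x \<in> C \<and> y \<in> C \<and> x \<noteq> y}"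
    using assms vec.subspace_0 by blast
  moreover have "finite {hamming_dist x y |x y. x \<in> C \<and> y \<in> C \<and> x \<noteq> y}"
    by (rule finite_subset[of _ "(\<lambda>(x, y). hamming_dist x y) ` UNIV"]) auto
  ultimately show ?thesis unfolding min_distance_def by (simp only: Min_le)
qed

theorem theorem4:
  fixes C :: "(('a::{field,finite}) ^ ('n::finite)) set"
    and q n :: nat
  assumes "q = CARD('a)"
    and "n = CARD('n)"
    and "4 dvd n"
    and "linear_code C"
    and "min_distance C = 6"
    and "has_locality 3 C"
    and "disjoint_repair_groups 3 C"
    and "singleton_optimal 3 C"
  shows "int n \<le> 4 * \<lfloor>(7 * real q + 3 + sqrt (24 * real q ^ 3 + real q ^ 2 - 6 * real q - 63)) / 24\<rfloor>
    \<and> (\<lambda>m::nat. real_of_int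
          (4 * \<lfloor>(7 * real m + 3 + sqrt (24 * real m ^ 3 + real m ^ 2 - 6 * real m - 63)) / 24\<rfloor>))
        \<in> O(\<lambda>m. real m powr (3 / 2))"
proof -
  obtain l where l: "n = 4 * l" using \<open>4 dvd n\<close> by blast
  then have "0 < l" using \<open>n = CARD('n)\<close> by (cases l) simp_all
  have C: "vec.subspace C" using \<open>linear_code C\<close> by (simp add: linear_code_def)
  have "CARD('n) div 4 = l" using l \<open>n = CARD('n)\<close> by simp
  then obtain h where h: "\<And>j. j < l \<Longrightarrow> h j \<in> dual_code C" "\<And>j. j < l \<Longrightarrow> card (supp (h j)) = 4"
    and disj: "disjoint_family_on (\<lambda>j. supp (h j)) {..<l}"
    using \<open>disjoint_repair_groups 3 C\<close>
    by (auto simp: disjoint_repair_groups_def hamming_weight_def)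
  \<comment> \<open>For d = 6 and n = 4l, optimality reads k + ceiling(k/3) = 4(l - 1).\<close>
  have dim: "vec.dim C + 3 = 3 * l"
    using \<open>singleton_optimal 3 C\<close> \<open>min_distance C = 6\<close> l \<open>n = CARD('n)\<close>
    by (intro dim_from_ceiling_equation) (simp add: singleton_optimal_def)
  let ?D = "{x :: 'a ^ 'n. \<forall>j<l. (\<Sum>i\<in>UNIV. h j $ i * x $ i) = 0}"
  have D: "vec.subspace ?D" by (rule subspace_orthogonal)
  have "vec.dim ?D + l \<le> 4 * l"
    using dim_orthogonal_disjoint_supports_le[OF disj] h l \<open>n = CARD('n)\<close> by fastforce
  \<comment> \<open>The bound 3l on the dimension of \<open>?D\<close> equals k + 3, which is why
    the geometry takes place in a projective plane.\<close>
  then have "vec.dim ?D \<le> vec.dim C + CARD(3)" using dim by simp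
  moreover have "C \<subseteq> ?D" using h by (auto simp: dual_code_def)
  ultimately obtain \<phi> :: "'a ^ 'n \<Rightarrow> 'a ^ 3"
    where \<phi>: "Vector_Spaces.linear (*s) (*s) \<phi>" "\<And>x. x \<in> ?D \<Longrightarrow> \<phi> x = 0 \<Longrightarrow> x \<in> C"
    using linear_map_with_small_kernel[OF C D] by blast
  interpret repair_groups h l \<phi>
  proof (rule repair_groups.intro)
    fix x assume "\<And>j. j < l \<Longrightarrow> (\<Sum>i\<in>UNIV. h j $ i * x $ i) = 0" "\<phi> x = 0" "card (supp x) \<le> 5"
    \<comment> \<open>Such a word lies in \<open>C\<close>, where nonzero words have weight at least
      6.\<close>
    then show "x = 0"
      using \<phi>(2)[of x] weight_ge_min_distance[OF C, of x] \<open>min_distance C = 6\<close>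
      by (force simp: hamming_weight_def)
  qed (use \<phi>(1) h disj in blast)+
  have "int l \<le> \<lfloor>(7 * real q + 3 + sqrt (24 * real q ^ 3 + real q ^ 2 - 6 * real q - 63)) / 24\<rfloor>"
    unfolding \<open>q = CARD('a)\<close> by (rule number_of_groups_bound[OF \<open>0 < l\<close>])
  then show ?thesis using l length_bound_bigo by simp
qed

end
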